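(* Let $n\ge1$ and $k\ge 2$ be integers, let $a=\lceil \frac{n+k}{2}\rceil$, and let $M_k=\sum_{i=a-k}^{a-1}\binom{n}{i}$ (the sum of the $k$ largest binomial coefficients $\binom ni$). Let $t_1$ be an integer and $t_2\ge 0$ an integer. Let $\mathcal{F}$ be a family of subsets of $[n]$ with $|\mathcal{F}|=M_k+t_1$, such that $1\le |F|\le n-2$ for all $F\in\mathcal{F}$, and such that at least $t_2$ subsets $G\subseteq[n]$ with $a-k+1\le |G|\le a-1$ are not in $\mathcal{F}$. Then the number $C(\mathcal{F})$ of $k$-chains in $\mathcal{F}$ satisfies \[ C(\mathcal{F}) \ge \binom{n}{a-k}\binom{n-a+k}{k-1}(k-1)! + \left(t_1+\frac{k-1}{a}\,t_2\right)\left(\binom{a}{k-1}+\binom{a}{k}\binom{k}{2}\right)(k-1)!. \]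
   Context: A $k$-chain in $\mathcal{F}$ is a collection of $k$ sets $F_1,\dots,F_k\in\mathcal{F}$ with $F_1\subsetneq\cdots\subsetneq F_k$; $C(\mathcal{F})$ is the number of such $k$-element subfamilies of $\mathcal{F}$ totally ordered by inclusion. *)

theory Defs
  imports Complex_Main
begin

text \<open>Binomial coefficients with an integer lower index. The index \<open>a - k\<close> below is negative
  once \<open>k \<ge> n + 2\<close>, where truncated subtraction on \<open>nat\<close> would wrongly yield \<open>n choose 0 = 1\<close>.\<close>

definition int_choose :: "nat \<Rightarrow> int \<Rightarrow> nat" where
  "int_choose n i = (if i < 0 then 0 else n choose nat i)"

definition upper_level :: "nat \<Rightarrow> nat \<Rightarrow> nat" where
  "upper_level n k = nat \<lceil>real (n + k) / 2\<rceil>"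

definition largest_layers :: "nat \<Rightarrow> nat \<Rightarrow> nat" where
  "largest_layers n k =
     (\<Sum>i = int (upper_level n k) - int k .. int (upper_level n k) - 1. int_choose n i)"

definition num_chains :: "nat \<Rightarrow> 'a set set \<Rightarrow> nat" where
  "num_chains k \<F> = card {\<C>. subset.chain \<F> \<C> \<and> finite \<C> \<and> card \<C> = k}"

end

(* Average over all maximal chains of subsets of [n]. If a maximal chain meets the family at the
   levels S and every k-subset of S is weighted with its multinomial coefficient, the total
   weight w(S) has mean the number of k-chains, while the mean of the sum of binom(n,i) over i in S is the
   size of the family. It therefore suffices to prove, for every set S of levels in [1, n-2],

     w(S) - D sum_{i in S} binom(n,i)
       >= base - D sum_{a-k <= i < a} binom(n,i)
            + (k-1)/a D sum_{a-k < i < a, i notin S} binom(n,i),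

   where base counts the k-chains in the k central layers and D the new ones created by adding
   a set of size a to these layers.
   If |S| > k, the minimum of S (when it is below a-k) or else its maximum (at least a) can be
   removed, since it takes part in chains of weight at least D binom(n,i). This uses that the levels
   on the far side stay at distance at least 2 from the end. If |S| <= k, the inequality follows
   by exchanging the levels of S outside the centre for missing central ones: with
   W = binom(n,a-1)(a-k+1)/a, levels outside have size at most W, central ones at least W even
   after the (k-1)/a discount, and base = W a(a-1)...(a-k+2). *)

theory Submission
  imports Defs "HOL-Combinatorics.Multiset_Permutations"
begin

section \<open>Falling factorials and binomial estimates\<close>

definition falling :: "nat \<Rightarrow> nat \<Rightarrow> real" where
  "falling b j = real (b choose j) * fact j"

lemma falling_0 [simp]: "falling b 0 = 1"
  by (simp add: falling_def)

lemma falling_nonneg: "falling b j \<ge> 0"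
  by (simp add: falling_def)

lemma choose_Suc_times: "(b choose Suc j) * Suc j = (b choose j) * (b - j)"
proof (cases "Suc j \<le> b")
  case True then show ?thesis using choose_mult[of j "Suc j" b] by simp
qed (simp add: not_le)

text \<open>Truncated subtraction is harmless: once \<open>j\<close> reaches \<open>b\<close>, both
  sides vanish.\<close>

lemma falling_Suc: "falling b (Suc j) = falling b j * real (b - j)"
proof -
  have "real (b choose Suc j) * real (Suc j) = real (b choose j) * real (b - j)"
    using choose_Suc_times by (metis of_nat_mult)
  moreover have "falling b (Suc j) = real (b choose Suc j) * real (Suc j) * fact j"
    by (simp only: falling_def fact_Suc of_nat_mult mult.assoc)
  ultimately show ?thesis
    by (simp add: falling_def mult_ac del: of_nat_Suc binomial_Suc_Suc)
qed

lemma falling_Suc_Suc: "falling (Suc b) (Suc j) = real (Suc b) * falling b j"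
proof -
  have "real (Suc j) * real (Suc b choose Suc j) = real (Suc b) * real (b choose j)"
    using Suc_times_binomial_eq[of b j] by (metis mult.commute of_nat_mult)
  moreover have "falling (Suc b) (Suc j) = real (Suc j) * real (Suc b choose Suc j) * fact j"
    by (simp only: falling_def fact_Suc of_nat_mult mult.assoc mult.left_commute)
  ultimately show ?thesis
    by (simp only: falling_def mult.assoc)
qed

lemma falling_pred:
  assumes "0 < a"
  shows "falling a j * real (a - j) = real a * falling (a - 1) j"
  using falling_Suc_Suc[of "a - 1" j] assms by (simp add: falling_Suc)

lemma falling_mono: "b \<le> c \<Longrightarrow> falling b j \<le> falling c j"
  by (simp add: falling_def binomial_right_mono)

lemma real_choose_two: "real (m choose 2) = real m * real (m - 1) / 2"
  using falling_Suc[of m 1] falling_Suc[of m 0] by (simp add: falling_def numeral_2_eq_2)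

text \<open>Double counting of the t-subsets of a b-set together with an injective j-sequence inside
  them: the sequence may be chosen first and then extended to the subset.\<close>

lemma choose_times_falling:
  assumes "j \<le> t" "t \<le> b"
  shows "real (b choose t) * falling t j = falling b j * real ((b - j) choose (t - j))"
  using choose_mult[OF assms] by (simp add: falling_def algebra_simps flip: of_nat_mult)

text \<open>The left side is \<open>W * falling a j\<close> for the threshold \<open>W\<close>
  introduced below. For j < a the right side counts the chains with one set in each of the layers a
  - 1 - j, ..., a - 1: a top set, then the successive removal of j elements.\<close>

lemma choose_times_falling_pred:
  assumes "0 < a"
  shows "real (n choose (a - 1)) * real (a - j) / real a * falling a j
       = real (n choose (a - 1)) * falling (a - 1) j"
proof -
  have "real (n choose (a - 1)) * real (a - j) / real a * falling a j
      = real (n choose (a - 1)) * (falling a j * real (a - j)) / real a" by simp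
  then show ?thesis unfolding falling_pred[OF assms] using assms by simp
qed

lemma choose_ge_self:
  assumes "1 \<le> t" "t < (m::nat)"
  shows "m \<le> m choose t"
proof -
  have "m choose 1 \<le> m choose t"
  proof (cases "2 * t \<le> m")
    case True then show ?thesis using assms by (intro binomial_mono) auto
  next
    case False
    have "m choose 1 = m choose (m - 1)" using assms binomial_symmetric[of 1 m] by simp
    also have "\<dots> \<le> m choose t" using assms False by (intro binomial_antimono) auto
    finally show ?thesis .
  qed
  then show ?thesis by simp
qed

lemma choose_ge_choose_two:
  assumes "2 \<le> t" "t + 2 \<le> (m::nat)"
  shows "m choose 2 \<le> m choose t"
proof (cases "2 * t \<le> m")
  case True then show ?thesis using assms by (intro binomial_mono) auto
next
  case False
  have "m choose 2 = m choose (m - 2)" using assms binomial_symmetric[of 2 m] by simp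
  also have "\<dots> \<le> m choose t" using assms False by (intro binomial_antimono) auto
  finally show ?thesis .
qed

section \<open>Weighted selections of levels\<close>

text \<open>Sum of the multinomial coefficients \<open>(h - l)! / \<Prod> (t\<^sub>i\<^sub>+\<^sub>1 - t\<^sub>i)!\<close> over all
  \<open>l = t\<^sub>0 < t\<^sub>1 < \<dots> < t\<^sub>j < t\<^sub>j\<^sub>+\<^sub>1 = h\<close> with inner levels in \<open>S\<close>.\<close>

primrec wchains :: "nat \<Rightarrow> nat \<Rightarrow> nat \<Rightarrow> nat set \<Rightarrow> real" where
  "wchains 0 l h S = 1"
| "wchains (Suc j) l h S = (\<Sum>t\<in>S \<inter> {l<..<h}. real ((h - l) choose (t - l)) * wchains j l t S)"

lemma wchains_nonneg: "wchains j l h S \<ge> 0"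
  by (induction j arbitrary: h) (auto intro!: sum_nonneg)

lemma wchains_cong:
  assumes "S \<inter> {l<..<h} = S' \<inter> {l<..<h}"
  shows "wchains j l h S = wchains j l h S'"
  using assms
proof (induction j arbitrary: h)
  case (Suc j)
  have "wchains j l t S = wchains j l t S'" if "t \<in> S' \<inter> {l<..<h}" for t
  proof (rule Suc.IH)
    have "S \<inter> {l<..<t} = S \<inter> {l<..<h} \<inter> {..<t}" using that by auto
    also have "\<dots> = S' \<inter> {l<..<t}" unfolding Suc.prems using that by auto
    finally show "S \<inter> {l<..<t} = S' \<inter> {l<..<t}" .
  qed
  then show ?case
    unfolding wchains.simps Suc.prems by (intro sum.cong) (rule refl, metis)
qed simp

text \<open>The defining recursion peels off the highest level; this one peels off the lowest. A
  multinomial coefficient can be built up from either end, which in the induction step is an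
  interchange of the two outer sums.\<close>

lemma wchains_Suc_bottom:
  "wchains (Suc j) l h S = (\<Sum>u\<in>S \<inter> {l<..<h}. real ((h - l) choose (u - l)) * wchains j u h S)"
proof (induction j arbitrary: h)
  case (Suc j)
  have "wchains (Suc (Suc j)) l h S
      = (\<Sum>t\<in>S \<inter> {l<..<h}. \<Sum>u\<in>S \<inter> {l<..<t}.
           real ((h - l) choose (t - l)) * real ((t - l) choose (u - l)) * wchains j u t S)"
    by (subst wchains.simps) (simp only: Suc.IH sum_distrib_left mult.assoc)
  also have "\<dots> = (\<Sum>t\<in>S \<inter> {l<..<h}. \<Sum>u\<in>{u\<in>S \<inter> {l<..<h}. u < t}.
           real ((h - l) choose (t - l)) * real ((t - l) choose (u - l)) * wchains j u t S)"
    by (intro sum.cong refl) auto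
  also have "\<dots> = (\<Sum>u\<in>S \<inter> {l<..<h}. \<Sum>t\<in>{t\<in>S \<inter> {l<..<h}. u < t}.
           real ((h - l) choose (t - l)) * real ((t - l) choose (u - l)) * wchains j u t S)"
    by (rule sum.swap_restrict[where A = "S \<inter> {l<..<h}" and B = "S \<inter> {l<..<h}"
          and R = "\<lambda>t u. u < t"]) simp_all
  also have "\<dots> = (\<Sum>u\<in>S \<inter> {l<..<h}. \<Sum>t\<in>S \<inter> {u<..<h}.
           real ((h - l) choose (u - l)) * (real ((h - u) choose (t - u)) * wchains j u t S))"
  proof (intro sum.cong)
    fix u t assume u: "u \<in> S \<inter> {l<..<h}" and t: "t \<in> S \<inter> {u<..<h}"
    have "((h - l) choose (t - l)) * ((t - l) choose (u - l))
        = ((h - l) choose (u - l)) * ((h - l - (u - l)) choose (t - l - (u - l)))"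
      using u t by (intro choose_mult) auto
    then have "((h - l) choose (t - l)) * ((t - l) choose (u - l))
        = ((h - l) choose (u - l)) * ((h - u) choose (t - u))"
      using u t by simp
    then have "real ((h - l) choose (t - l)) * real ((t - l) choose (u - l))
        = real ((h - l) choose (u - l)) * real ((h - u) choose (t - u))"
      by (metis of_nat_mult)
    then show "real ((h - l) choose (t - l)) * real ((t - l) choose (u - l)) * wchains j u t S
        = real ((h - l) choose (u - l)) * (real ((h - u) choose (t - u)) * wchains j u t S)"
      by simp
  qed auto
  also have "\<dots> = (\<Sum>u\<in>S \<inter> {l<..<h}. real ((h - l) choose (u - l)) * wchains (Suc j) u h S)"
    by (simp add: sum_distrib_left)
  finally show ?case .
qed simp

text \<open>Reversing the order of the parts does not change a multinomial coefficient. This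
  transfers bounds for the levels below a given level to the levels above it.\<close>

lemma wchains_reflect:
  assumes "l \<le> h" "h \<le> n"
  shows "wchains j l h S = wchains j (n - h) (n - l) {u. u \<le> n \<and> n - u \<in> S}"
  using assms
proof (induction j arbitrary: l)
  case (Suc j)
  let ?R = "{u. u \<le> n \<and> n - u \<in> S}"
  have "wchains (Suc j) l h S
      = (\<Sum>u\<in>S \<inter> {l<..<h}. real ((h - l) choose (u - l)) * wchains j u h S)"
    by (rule wchains_Suc_bottom)
  also have "\<dots> = (\<Sum>t\<in>?R \<inter> {n - h<..<n - l}.
      real ((n - l - (n - h)) choose (t - (n - h))) * wchains j (n - h) t ?R)"
  proof (rule sum.reindex_bij_witness[where i = "\<lambda>t. n - t" and j = "\<lambda>u. n - u"])
    fix u assume u: "u \<in> S \<inter> {l<..<h}"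
    have "(h - l) choose (u - l) = (h - l) choose (h - u)"
      using u binomial_symmetric[of "u - l" "h - l"] by auto
    moreover have "n - l - (n - h) = h - l" "n - u - (n - h) = h - u"
      using Suc.prems u by auto
    ultimately show "real ((n - l - (n - h)) choose (n - u - (n - h))) * wchains j (n - h) (n - u) ?R
        = real ((h - l) choose (u - l)) * wchains j u h S"
      using Suc.IH[of u] Suc.prems u by simp
  qed (use Suc.prems in auto)
  finally show ?case by simp
qed simp

text \<open>A selection of levels that contains the maximum \<open>b\<close> has it as its top, so
  one step of the recursion isolates exactly these selections; the others live in
  \<open>S - {b}\<close>.\<close>

lemma wchains_split_max:
  assumes "b \<in> S" "b < h" "l < b" "\<And>t. t \<in> S \<Longrightarrow> t < h \<Longrightarrow> t \<le> b"
  shows "wchains (Suc j) l h S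
    = real ((h - l) choose (b - l)) * wchains j l b S + wchains (Suc j) l h (S - {b})"
proof -
  have "S \<inter> {l<..<h} = insert b ((S - {b}) \<inter> {l<..<h})"
    using assms by auto
  moreover have "wchains j l t S = wchains j l t (S - {b})" if "t \<in> (S - {b}) \<inter> {l<..<h}" for t
    using that assms(4)[of t] by (intro wchains_cong) auto
  ultimately have "(\<Sum>t\<in>S \<inter> {l<..<h}. real ((h - l) choose (t - l)) * wchains j l t S)
      = real ((h - l) choose (b - l)) * wchains j l b S
        + (\<Sum>t\<in>(S - {b}) \<inter> {l<..<h}. real ((h - l) choose (t - l)) * wchains j l t (S - {b}))"
    by (subst \<open>S \<inter> {l<..<h} = _\<close>, subst sum.insert) (auto intro!: sum.cong)
  then show ?thesis
    by simp
qed

lemma wchains_split_min: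
  assumes "b \<in> S" "b < h" "l < b" "\<And>t. t \<in> S \<Longrightarrow> l < t \<Longrightarrow> b \<le> t"
  shows "wchains (Suc j) l h S
    = real ((h - l) choose (b - l)) * wchains j b h S + wchains (Suc j) l h (S - {b})"
proof -
  have "S \<inter> {l<..<h} = insert b ((S - {b}) \<inter> {l<..<h})"
    using assms by auto
  moreover have "wchains j t h S = wchains j t h (S - {b})" if "t \<in> (S - {b}) \<inter> {l<..<h}" for t
    using that assms(4)[of t] by (intro wchains_cong) auto
  ultimately have "(\<Sum>t\<in>S \<inter> {l<..<h}. real ((h - l) choose (t - l)) * wchains j t h S)
      = real ((h - l) choose (b - l)) * wchains j b h S
        + (\<Sum>t\<in>(S - {b}) \<inter> {l<..<h}. real ((h - l) choose (t - l)) * wchains j t h (S - {b}))"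
    by (subst \<open>S \<inter> {l<..<h} = _\<close>, subst sum.insert) (auto intro!: sum.cong)
  then show ?thesis
    by (simp only: wchains_Suc_bottom)
qed

section \<open>Lower bounds in terms of the number of levels\<close>

text \<open>A multinomial coefficient with a prescribed number of positive parts is smallest when all
  parts but one are 1.\<close>

lemma wchains_ge_falling:
  assumes "S \<subseteq> {1..<b}" "j \<le> card S"
  shows "falling b j \<le> wchains j 0 b S"
  using assms
proof (induction j arbitrary: b S)
  case (Suc j)
  have fin: "finite S" using Suc.prems(1) by (rule finite_subset) simp
  define t where "t = Max S"
  have ne: "S \<noteq> {}" using Suc.prems by auto
  have t: "t \<in> S" "\<And>u. u \<in> S \<Longrightarrow> u \<le> t" using fin ne by (auto simp: t_def)
  have sub: "S - {t} \<subseteq> {1..<t}"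
  proof
    fix u assume "u \<in> S - {t}"
    then show "u \<in> {1..<t}" using t(2)[of u] Suc.prems(1) by auto
  qed
  have card: "j \<le> card (S - {t})" using Suc.prems fin t by simp
  have "t \<in> {1..<b}" using t Suc.prems by blast
  then have tb: "1 \<le> t" "t < b" by auto
  have jt: "j < t" using card_mono[OF _ sub] card tb by simp
  have "falling b (Suc j) = falling b j * real (b - j)" by (rule falling_Suc)
  also have "\<dots> \<le> falling b j * real ((b - j) choose (t - j))"
    using jt tb by (intro mult_left_mono falling_nonneg of_nat_mono choose_ge_self) auto
  also have "\<dots> = real (b choose t) * falling t j"
    using jt tb by (simp add: choose_times_falling)
  also have "\<dots> \<le> real (b choose t) * wchains j 0 t (S - {t})"
    using Suc.IH[OF sub card] by (intro mult_left_mono) auto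
  also have "wchains j 0 t (S - {t}) = wchains j 0 t S"
    by (rule wchains_cong) auto
  also have "real (b choose t) * wchains j 0 t S \<le> wchains (Suc j) 0 b S"
    using wchains_split_max[of t S b 0 j] t tb jt wchains_nonneg[of "Suc j" 0 b "S - {t}"] by simp
  finally show ?case .
qed simp

text \<open>A selection of j + 1 levels has j + 2 parts, and here both the first and the last part
  are at least 2. Under this restriction the multinomial coefficient is smallest for j parts equal
  to 1, one equal to 2 and one equal to b - j - 2, which is the bound.\<close>

lemma wchains_ge_falling_half:
  assumes "S \<subseteq> {2..b - 2}" "Suc j \<le> card S"
  shows "falling b (Suc (Suc j)) / 2 \<le> wchains (Suc j) 0 b S"
proof -
  have fin: "finite S" using assms(1) by (rule finite_subset) simp
  define t where "t = Max S"
  have ne: "S \<noteq> {}" using assms by auto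
  have t: "t \<in> S" "\<And>u. u \<in> S \<Longrightarrow> u \<le> t" using fin ne by (auto simp: t_def)
  have sub: "S - {t} \<subseteq> {2..<t}"
  proof
    fix u assume "u \<in> S - {t}"
    then show "u \<in> {2..<t}" using t(2)[of u] assms(1) by auto
  qed
  have card: "j \<le> card (S - {t})" using assms fin t by simp
  have "t \<in> {2..b - 2}" using t assms by blast
  then have tb: "2 \<le> t" "t + 2 \<le> b" by auto
  have jt: "j + 2 \<le> t" using card_mono[OF _ sub] card tb by simp
  have "falling b (Suc (Suc j)) / 2 = falling b j * real ((b - j) choose 2)"
    unfolding falling_Suc real_choose_two by simp
  also have "\<dots> \<le> falling b j * real ((b - j) choose (t - j))"
    using jt tb by (intro mult_left_mono falling_nonneg of_nat_mono choose_ge_choose_two) auto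
  also have "\<dots> = real (b choose t) * falling t j"
    using jt tb by (simp add: choose_times_falling)
  also have "\<dots> \<le> real (b choose t) * wchains j 0 t (S - {t})"
    using sub card by (intro mult_left_mono wchains_ge_falling) auto
  also have "wchains j 0 t (S - {t}) = wchains j 0 t S"
    by (rule wchains_cong) auto
  also have "real (b choose t) * wchains j 0 t S \<le> wchains (Suc j) 0 b S"
    using wchains_split_max[of t S b 0 j] t tb jt wchains_nonneg[of "Suc j" 0 b "S - {t}"] by simp
  finally show ?thesis .
qed

text \<open>The number of chains of \<open>j + 1\<close> sets in the layers \<open>b - j - 1, \<dots>, b\<close> whose top is a given
  \<open>b\<close>-set: either the bottom layer is skipped or one of the \<open>j\<close> others.\<close>

definition extra :: "nat \<Rightarrow> nat \<Rightarrow> real" where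
  "extra b j = falling b j + real j / 2 * falling b (Suc j)"

lemma extra_mono: "b \<le> c \<Longrightarrow> extra b j \<le> extra c j"
  by (simp add: extra_def add_mono mult_left_mono falling_mono)

lemma falling_le_extra: "falling b j \<le> extra b j"
  by (simp add: extra_def falling_nonneg)

text \<open>The hypothesis \<open>2 \<le> Min S\<close> is essential: \<open>S = {1, b - 1}\<close>, \<open>j = 1\<close> gives only \<open>2 * b\<close>.\<close>

lemma wchains_ge_extra:
  assumes "S \<subseteq> {2..<b}" "Suc j \<le> card S"
  shows "extra b j \<le> wchains j 0 b S"
  using assms
proof (induction j arbitrary: b S)
  case 0 then show ?case by (simp add: extra_def)
next
  case (Suc j)
  have fin: "finite S" using Suc.prems(1) by (rule finite_subset) simp
  define t where "t = Max S"
  have ne: "S \<noteq> {}" using Suc.prems by auto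
  have t: "t \<in> S" "\<And>u. u \<in> S \<Longrightarrow> u \<le> t" using fin ne by (auto simp: t_def)
  have sub: "S - {t} \<subseteq> {2..<t}"
  proof
    fix u assume "u \<in> S - {t}"
    then show "u \<in> {2..<t}" using t(2)[of u] Suc.prems(1) by auto
  qed
  have card: "Suc j \<le> card (S - {t})" using Suc.prems fin t by simp
  have "t \<in> {2..<b}" using t Suc.prems by blast
  then have tb: "2 \<le> t" "t < b" by auto
  have jt: "j + 3 \<le> t" using card_mono[OF _ sub] card tb by simp
  \<comment> \<open>The coefficient (j + 1)/2 in \<open>extra b (Suc j)\<close> splits as j/2 + 1/2.
    Selections through the maximum \<open>t\<close> supply the leading term and the share j/2 by
    induction; those avoiding \<open>t\<close> supply the 1/2, since their levels are at most b -
    2.\<close>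
  have 1: "falling b (Suc j) \<le> real (b choose t) * falling t j"
  proof -
    have "falling b (Suc j) \<le> falling b j * real ((b - j) choose (t - j))"
      unfolding falling_Suc using jt tb
      by (intro mult_left_mono falling_nonneg of_nat_mono choose_ge_self) auto
    then show ?thesis using jt tb by (simp add: choose_times_falling)
  qed
  have 2: "falling b (Suc (Suc j)) \<le> real (b choose t) * falling t (Suc j)"
  proof -
    have "falling b (Suc (Suc j)) \<le> falling b (Suc j) * real ((b - Suc j) choose (t - Suc j))"
      unfolding falling_Suc[of b "Suc j"] using jt tb
      by (intro mult_left_mono falling_nonneg of_nat_mono choose_ge_self) auto
    then show ?thesis using jt tb by (simp add: choose_times_falling)
  qed
  have "falling b (Suc j) + real j / 2 * falling b (Suc (Suc j)) \<le> real (b choose t) * extra t j"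
    using 1 mult_left_mono[OF 2, of "real j / 2"] by (simp add: extra_def algebra_simps)
  also have "\<dots> \<le> real (b choose t) * wchains j 0 t (S - {t})"
    using Suc.IH[OF sub card] by (intro mult_left_mono) auto
  also have "wchains j 0 t (S - {t}) = wchains j 0 t S"
    by (rule wchains_cong) auto
  finally have "falling b (Suc j) + real j / 2 * falling b (Suc (Suc j))
    \<le> real (b choose t) * wchains j 0 t S" .
  moreover have "falling b (Suc (Suc j)) / 2 \<le> wchains (Suc j) 0 b (S - {t})"
    using tb card by (intro wchains_ge_falling_half subset_trans[OF sub]) auto
  moreover have "wchains (Suc j) 0 b S
      = real (b choose t) * wchains j 0 t S + wchains (Suc j) 0 b (S - {t})"
    using wchains_split_max[of t S b 0 j] t tb by simp
  ultimately show ?case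
    by (simp add: extra_def field_simps)
qed

section \<open>Counting chains by averaging over maximal chains\<close>

lemma num_chains_0 [simp]: "num_chains 0 \<F> = 1"
proof -
  have "{\<C>. subset.chain \<F> \<C> \<and> finite \<C> \<and> card \<C> = 0} = {{}}"
    by (auto simp: subset_chain_def)
  then show ?thesis by (simp add: num_chains_def)
qed

text \<open>Chains are grouped by their largest member. It equals the union of the chain, so the
  groups are disjoint, and deleting it inverts the insertion of \<open>B\<close>.\<close>

lemma num_chains_Suc:
  assumes "finite \<F>"
  shows "num_chains (Suc k) \<F> = (\<Sum>B\<in>\<F>. num_chains k {C \<in> \<F>. C \<subset> B})"
proof -
  define \<D> where "\<D> B = {\<C>. subset.chain {C \<in> \<F>. C \<subset> B} \<C> \<and> finite \<C> \<and> card \<C> = k}" for B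
  have sub: "\<D> B \<subseteq> Pow \<F>" for B
    by (auto simp: \<D>_def subset_chain_def)
  then have fin: "finite (\<D> B)" for B
    using assms by (meson finite_Pow_iff finite_subset)
  have top: "B \<notin> \<C>" "\<Union>(insert B \<C>) = B" if "\<C> \<in> \<D> B" for B \<C>
    using that by (auto simp: \<D>_def subset_chain_def)
  have "{\<C>. subset.chain \<F> \<C> \<and> finite \<C> \<and> card \<C> = Suc k} = (\<Union>B\<in>\<F>. insert B ` \<D> B)" (is "?L = ?R")
  proof (intro equalityI subsetI)
    fix \<C> assume "\<C> \<in> ?L"
    then have \<C>: "\<C> \<subseteq> \<F>" "\<And>X Y. X \<in> \<C> \<Longrightarrow> Y \<in> \<C> \<Longrightarrow> X \<subseteq> Y \<or> Y \<subseteq> X" "finite \<C>" "card \<C> = Suc k"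
        "subset.chain \<F> \<C>"
      by (auto simp: subset_chain_def)
    define B where "B = \<Union>\<C>"
    have B: "B \<in> \<C>" unfolding B_def using \<C> by (intro Union_in_chain) auto
    have "X \<subset> B" if "X \<in> \<C> - {B}" for X
      using that unfolding B_def by auto
    then have "\<C> - {B} \<in> \<D> B"
      using \<C> B by (auto simp: \<D>_def subset_chain_def)
    moreover have "\<C> = insert B (\<C> - {B})" using B by auto
    ultimately show "\<C> \<in> ?R" using B \<C>(1) by blast
  next
    fix \<C> assume "\<C> \<in> ?R"
    then obtain B \<C>' where "B \<in> \<F>" "\<C>' \<in> \<D> B" "\<C> = insert B \<C>'" by blast
    moreover from this have "B \<notin> \<C>'" using top by blast
    ultimately show "\<C> \<in> ?L"
      by (auto simp: \<D>_def subset_chain_def)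
  qed
  then have "num_chains (Suc k) \<F> = card (\<Union>B\<in>\<F>. insert B ` \<D> B)"
    by (simp add: num_chains_def)
  also have "\<dots> = (\<Sum>B\<in>\<F>. card (insert B ` \<D> B))"
  proof (rule card_UN_disjoint)
    show "\<forall>B\<in>\<F>. \<forall>B'\<in>\<F>. B \<noteq> B' \<longrightarrow> insert B ` \<D> B \<inter> insert B' ` \<D> B' = {}"
      using top(2) by (metis (no_types, lifting) disjoint_iff image_iff)
  qed (use assms fin in auto)
  also have "\<dots> = (\<Sum>B\<in>\<F>. card (\<D> B))"
  proof (intro sum.cong refl card_image inj_onI)
    fix B \<C> \<C>' assume "\<C> \<in> \<D> B" "\<C>' \<in> \<D> B" "insert B \<C> = insert B \<C>'"
    then show "\<C> = \<C>'" using top(1) by (metis insert_ident)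
  qed
  finally show ?thesis by (simp add: num_chains_def \<D>_def)
qed

text \<open>Cutting a permutation of \<open>A\<close> at position \<open>t\<close> is a bijection
  onto triples of a subset \<open>B\<close>, an ordering of \<open>B\<close> and an ordering of the
  rest. Letting \<open>g\<close> depend on the ordered prefix makes the identity usable in an
  induction on prefixes.\<close>

lemma sum_permutations_of_set_prefix:
  fixes g :: "'a list \<Rightarrow> real"
  assumes "finite A"
  shows "(\<Sum>xs\<in>permutations_of_set A. \<Sum>t | t \<le> card A \<and> P (set (take t xs)). g (take t xs))
       = (\<Sum>B | B \<subseteq> A \<and> P B. fact (card A - card B) * (\<Sum>ys\<in>permutations_of_set B. g ys))"
proof -
  have fin: "finite B" if "B \<subseteq> A" for B using that assms finite_subset by blast
  have len: "length xs = card A" if "xs \<in> permutations_of_set A" for xs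
    using that by (auto simp: permutations_of_set_def distinct_card)
  have "(\<Sum>xs\<in>permutations_of_set A. \<Sum>t | t \<le> card A \<and> P (set (take t xs)). g (take t xs))
      = (\<Sum>(xs, t)\<in>(SIGMA xs:permutations_of_set A. {t. t \<le> card A \<and> P (set (take t xs))}).
          g (take t xs))"
    by (rule sum.Sigma) auto
  also have "\<dots> = (\<Sum>(B, ys, zs)\<in>(SIGMA B:{B. B \<subseteq> A \<and> P B}.
                   permutations_of_set B \<times> permutations_of_set (A - B)). g ys)"
  proof (rule sum.reindex_bij_witness[where
        i = "\<lambda>(B, ys, zs). (ys @ zs, card B)" and
        j = "\<lambda>(xs, t). (set (take t xs), take t xs, drop t xs)"])
    fix p assume p: "p \<in> (SIGMA xs:permutations_of_set A. {t. t \<le> card A \<and> P (set (take t xs))})"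
    obtain xs t where xt: "p = (xs, t)" by force
    from p have xs: "set xs = A" "distinct xs" "t \<le> card A" "P (set (take t xs))" "length xs = card A"
      by (auto simp: xt permutations_of_set_def distinct_card)
    have "set (take t xs) \<union> set (drop t xs) = A"
      using xs(1) by (metis append_take_drop_id set_append)
    moreover have "set (take t xs) \<inter> set (drop t xs) = {}"
      using xs(2) by (simp add: set_take_disj_set_drop_if_distinct)
    ultimately have drop: "set (drop t xs) = A - set (take t xs)" by blast
    have card: "card (set (take t xs)) = t"
      using xs by (simp add: distinct_card)
    show "(case case p of (xs, t) \<Rightarrow> (set (take t xs), take t xs, drop t xs) of
            (B, ys, zs) \<Rightarrow> (ys @ zs, card B)) = p"
      by (simp add: xt card)
    show "(case p of (xs, t) \<Rightarrow> (set (take t xs), take t xs, drop t xs))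
        \<in> (SIGMA B:{B. B \<subseteq> A \<and> P B}. permutations_of_set B \<times> permutations_of_set (A - B))"
      using xs drop set_take_subset[of t xs] by (auto simp: xt intro!: permutations_of_setI)
    show "(case case p of (xs, t) \<Rightarrow> (set (take t xs), take t xs, drop t xs) of (B, ys, zs) \<Rightarrow> g ys)
        = (case p of (xs, t) \<Rightarrow> g (take t xs))"
      by (simp add: xt)
  next
    fix q assume q: "q \<in> (SIGMA B:{B. B \<subseteq> A \<and> P B}. permutations_of_set B \<times> permutations_of_set (A - B))"
    obtain B ys zs where byz: "q = (B, ys, zs)" using prod_cases3 by blast
    from q have q': "B \<subseteq> A" "P B" "ys \<in> permutations_of_set B" "zs \<in> permutations_of_set (A - B)"
      by (simp_all add: byz)
    note B = q'(1,2) permutations_of_setD[OF q'(3)] permutations_of_setD[OF q'(4)]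
    have "length ys = card B" using distinct_card[OF B(4)] B(3) by simp
    moreover have "card B \<le> card A" using B(1) assms by (rule card_mono[rotated])
    ultimately show "(case case q of (B, ys, zs) \<Rightarrow> (ys @ zs, card B) of
        (xs, t) \<Rightarrow> (set (take t xs), take t xs, drop t xs)) = q"
      and "(case q of (B, ys, zs) \<Rightarrow> (ys @ zs, card B))
        \<in> (SIGMA xs:permutations_of_set A. {t. t \<le> card A \<and> P (set (take t xs))})"
      using B by (auto simp: byz intro!: permutations_of_setI)
  qed
  also have "\<dots> = (\<Sum>B | B \<subseteq> A \<and> P B. \<Sum>(ys, zs)\<in>permutations_of_set B \<times> permutations_of_set (A - B). g ys)"
    using assms by (subst sum.Sigma) auto
  also have "\<dots> = (\<Sum>B | B \<subseteq> A \<and> P B. fact (card A - card B) * (\<Sum>ys\<in>permutations_of_set B. g ys))"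
  proof (intro sum.cong refl)
    fix B assume "B \<in> {B. B \<subseteq> A \<and> P B}"
    then have "B \<subseteq> A" by simp
    then show "(\<Sum>(ys, zs)\<in>permutations_of_set B \<times> permutations_of_set (A - B). g ys)
        = fact (card A - card B) * (\<Sum>ys\<in>permutations_of_set B. g ys)"
      using assms fin[of B]
      by (simp add: card_Diff_subset sum_distrib_left flip: sum.cartesian_product)
  qed
  finally show ?thesis .
qed

text \<open>A maximal chain of subsets of \<open>A\<close> is encoded by the permutation of \<open>A\<close> whose prefixes are
  its members; \<open>levels \<F> xs\<close> are the cardinalities at which it meets \<open>\<F>\<close>.\<close>

definition levels :: "'a set set \<Rightarrow> 'a list \<Rightarrow> nat set" where
  "levels \<F> xs = {t. set (take t xs) \<in> \<F>}"

text \<open>Induction on \<open>k\<close> over all ground sets at once: cutting a permutation at the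
  prefix \<open>B\<close> of the top level leaves a permutation of \<open>B\<close>, to which the
  hypothesis applies. The binomial weight of the level turns the factors |B|! and (|A| - |B|)! into
  |A|!, so each chain contributes exactly \<open>fact (card A)\<close>. The empty set is excluded
  because \<open>wchains\<close> sees only levels above 0.\<close>

lemma sum_wchains_levels:
  assumes "finite A" "{} \<notin> \<F>"
  shows "(\<Sum>xs\<in>permutations_of_set A. wchains k 0 (card A) (levels \<F> xs))
       = fact (card A) * real (num_chains k {B \<in> \<F>. B \<subset> A})"
  using assms(1)
proof (induction k arbitrary: A)
  case (Suc k)
  let ?g = "\<lambda>ys. real (card A choose length ys) * wchains k 0 (length ys) (levels \<F> ys)"
  have "wchains (Suc k) 0 (card A) (levels \<F> xs)
      = (\<Sum>t | t \<le> card A \<and> set (take t xs) \<in> \<F> \<and> set (take t xs) \<subset> A. ?g (take t xs))"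
    if "xs \<in> permutations_of_set A" for xs
  proof -
    have xs: "set xs = A" "distinct xs" "length xs = card A"
      using that by (auto simp: permutations_of_set_def distinct_card)
    have proper: "set (take t xs) \<subset> A \<longleftrightarrow> t < card A" if "t \<le> card A" for t
    proof -
      have "card (set (take t xs)) = t" using that xs by (simp add: distinct_card)
      then have "set (take t xs) = A \<longleftrightarrow> t = card A" using xs by auto
      moreover have "set (take t xs) \<subseteq> A" using set_take_subset[of t xs] xs(1) by simp
      ultimately show ?thesis using that by (auto simp: psubset_eq)
    qed
    have "levels \<F> xs \<inter> {0<..<card A}
        = {t. t \<le> card A \<and> set (take t xs) \<in> \<F> \<and> set (take t xs) \<subset> A}"
    proof (intro equalityI subsetI)
      fix t assume "t \<in> levels \<F> xs \<inter> {0<..<card A}"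
      then show "t \<in> {t. t \<le> card A \<and> set (take t xs) \<in> \<F> \<and> set (take t xs) \<subset> A}"
        using proper[of t] by (simp add: levels_def)
    next
      fix t assume "t \<in> {t. t \<le> card A \<and> set (take t xs) \<in> \<F> \<and> set (take t xs) \<subset> A}"
      then have t: "t \<le> card A" "set (take t xs) \<in> \<F>" "set (take t xs) \<subset> A" by simp_all
      then have "t \<noteq> 0" using assms(2) by (intro notI) simp
      then show "t \<in> levels \<F> xs \<inter> {0<..<card A}"
        using t proper[of t] by (simp add: levels_def)
    qed
    \<comment> \<open>Below position \<open>t\<close>, the permutation and its prefix have the same
      prefixes, and no other level enters.\<close>
    moreover have "wchains k 0 t (levels \<F> xs) = wchains k 0 t (levels \<F> (take t xs))" for t
      by (rule wchains_cong) (auto simp: levels_def min_def)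
    moreover have "length (take t xs) = t" if "t \<le> card A" for t
      using that xs(3) by simp
    ultimately show ?thesis by simp
  qed
  then have "(\<Sum>xs\<in>permutations_of_set A. wchains (Suc k) 0 (card A) (levels \<F> xs))
      = (\<Sum>xs\<in>permutations_of_set A.
          \<Sum>t | t \<le> card A \<and> set (take t xs) \<in> \<F> \<and> set (take t xs) \<subset> A. ?g (take t xs))"
    by (intro sum.cong refl)
  also have "\<dots> = (\<Sum>B | B \<subseteq> A \<and> B \<in> \<F> \<and> B \<subset> A.
      fact (card A - card B) * (\<Sum>ys\<in>permutations_of_set B. ?g ys))"
    using Suc.prems by (rule sum_permutations_of_set_prefix)
  also have "\<dots> = (\<Sum>B | B \<in> \<F> \<and> B \<subset> A. fact (card A) * real (num_chains k {C \<in> \<F>. C \<subset> B}))"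
  proof (intro sum.cong)
    fix B assume "B \<in> {B. B \<in> \<F> \<and> B \<subset> A}"
    then have B: "B \<subset> A" "finite B" using Suc.prems finite_subset by auto
    then have le: "card B \<le> card A" using Suc.prems by (simp add: card_mono psubset_imp_subset)
    have "(\<Sum>ys\<in>permutations_of_set B. ?g ys)
        = real (card A choose card B) * (\<Sum>ys\<in>permutations_of_set B. wchains k 0 (card B) (levels \<F> ys))"
      unfolding sum_distrib_left
      by (intro sum.cong refl) (auto simp: permutations_of_set_def distinct_card)
    also have "\<dots> = real (card A choose card B) * (fact (card B) * real (num_chains k {C \<in> \<F>. C \<subset> B}))"
      by (simp only: Suc.IH[OF B(2)])
    finally have "fact (card A - card B) * (\<Sum>ys\<in>permutations_of_set B. ?g ys)
        = (fact (card B) * fact (card A - card B) * real (card A choose card B))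
          * real (num_chains k {C \<in> \<F>. C \<subset> B})"
      by simp
    then show "fact (card A - card B) * (\<Sum>ys\<in>permutations_of_set B. ?g ys)
        = fact (card A) * real (num_chains k {C \<in> \<F>. C \<subset> B})"
      using binomial_fact_lemma[OF le] by (metis (no_types, lifting) of_nat_fact of_nat_mult)
  qed auto
  also have "\<dots> = fact (card A) * real (num_chains (Suc k) {B \<in> \<F>. B \<subset> A})"
  proof -
    have "finite {B \<in> \<F>. B \<subset> A}"
      using Suc.prems by (auto intro: finite_subset[of _ "Pow A"])
    moreover have "{C \<in> {B \<in> \<F>. B \<subset> A}. C \<subset> B} = {C \<in> \<F>. C \<subset> B}" if "B \<subset> A" for B
      using that by auto
    ultimately show ?thesis
      by (simp add: num_chains_Suc sum_distrib_left)
  qed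
  finally show ?case .
qed simp

text \<open>A t-set lies on t! (n - t)! of the n! maximal chains, and the weight binom(n, t) evens
  this out. The cut at \<open>card A\<close> matters: if \<open>A\<close> belongs to the family,
  \<open>levels\<close> contains every larger number too.\<close>

lemma sum_choose_levels:
  assumes "finite A" "\<F> \<subseteq> Pow A"
  shows "(\<Sum>xs\<in>permutations_of_set A. \<Sum>t\<in>{..card A} \<inter> levels \<F> xs. real (card A choose t))
       = fact (card A) * real (card \<F>)"
proof -
  have "(\<Sum>xs\<in>permutations_of_set A. \<Sum>t\<in>{..card A} \<inter> levels \<F> xs. real (card A choose t))
      = (\<Sum>xs\<in>permutations_of_set A. \<Sum>t | t \<le> card A \<and> set (take t xs) \<in> \<F>.
           real (card A choose length (take t xs)))"
  proof (intro sum.cong refl)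
    fix xs t assume "xs \<in> permutations_of_set A" "t \<in> {t. t \<le> card A \<and> set (take t xs) \<in> \<F>}"
    then show "real (card A choose t) = real (card A choose length (take t xs))"
      by (auto simp: permutations_of_set_def distinct_card)
  qed (auto simp: levels_def)
  also have "\<dots> = (\<Sum>B | B \<subseteq> A \<and> B \<in> \<F>. fact (card A - card B)
      * (\<Sum>ys\<in>permutations_of_set B. real (card A choose length ys)))"
    by (rule sum_permutations_of_set_prefix[OF assms(1)])
  also have "\<dots> = (\<Sum>B\<in>\<F>. fact (card A))"
  proof (intro sum.cong)
    fix B assume "B \<in> \<F>"
    then have "B \<subseteq> A" using assms(2) by blast
    then have B: "finite B" "card B \<le> card A"
      using assms(1) by (auto intro: card_mono finite_subset)
    have "(\<Sum>ys\<in>permutations_of_set B. real (card A choose length ys))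
        = (\<Sum>ys\<in>permutations_of_set B. real (card A choose card B))"
      by (intro sum.cong refl) (auto simp: permutations_of_set_def distinct_card)
    then have "fact (card A - card B) * (\<Sum>ys\<in>permutations_of_set B. real (card A choose length ys))
        = fact (card B) * fact (card A - card B) * real (card A choose card B)"
      using B by simp
    then show "fact (card A - card B) * (\<Sum>ys\<in>permutations_of_set B. real (card A choose length ys))
        = fact (card A)"
      using binomial_fact_lemma[OF B(2)] by (metis (no_types, lifting) of_nat_fact of_nat_mult)
  qed (use assms in auto)
  finally show ?thesis by simp
qed

section \<open>Removing a level outside the centre\<close>

text \<open>Reflection turns the levels above the minimum \<open>s\<close> into levels below
  \<open>n - s\<close>. As all of \<open>S\<close> is at most n - 2, the reflected levels are at
  least 2, which is what the bound by \<open>extra\<close> requires.\<close>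

lemma wchains_bottom_ge:
  assumes "S \<subseteq> {1..n - 2}" "s \<in> S" "\<And>t. t \<in> S \<Longrightarrow> s \<le> t"
  shows "j < card S \<Longrightarrow> falling (n - s) j \<le> wchains j s n S"
    and "Suc j < card S \<Longrightarrow> extra (n - s) j \<le> wchains j s n S"
proof -
  let ?R = "(\<lambda>t. n - t) ` (S - {s})"
  have fin: "finite S" using assms(1) by (rule finite_subset) simp
  have S: "1 \<le> t" "t + 2 \<le> n" if "t \<in> S" for t
    using assms(1) that by fastforce+
  have "inj_on (\<lambda>t. n - t) (S - {s})"
  proof (rule inj_onI)
    fix x y assume "x \<in> S - {s}" "y \<in> S - {s}" "n - x = n - y"
    then show "x = y" using S[of x] S[of y] by auto
  qed
  then have card: "card ?R = card S - 1"
    using assms(2) fin by (simp add: card_image)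
  have sub: "?R \<subseteq> {2..<n - s}"
  proof
    fix u assume "u \<in> ?R"
    then obtain t where t: "t \<in> S" "t \<noteq> s" "u = n - t" by auto
    then show "u \<in> {2..<n - s}" using S[of t] assms(3)[of t] by auto
  qed
  have "wchains j s n S = wchains j (n - n) (n - s) {u. u \<le> n \<and> n - u \<in> S}" for j
    using S[OF assms(2)] by (intro wchains_reflect) auto
  moreover have "wchains j 0 (n - s) {u. u \<le> n \<and> n - u \<in> S} = wchains j 0 (n - s) ?R" for j
  proof (rule wchains_cong, intro equalityI subsetI)
    fix u assume "u \<in> {u. u \<le> n \<and> n - u \<in> S} \<inter> {0<..<n - s}"
    then have "n - u \<in> S - {s}" "u = n - (n - u)" "u \<in> {0<..<n - s}" by auto
    then show "u \<in> ?R \<inter> {0<..<n - s}" by blast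
  next
    fix u assume "u \<in> ?R \<inter> {0<..<n - s}"
    then obtain t where t: "t \<in> S" "u = n - t" "u \<in> {0<..<n - s}" by blast
    then show "u \<in> {u. u \<le> n \<and> n - u \<in> S} \<inter> {0<..<n - s}" using S[of t] by auto
  qed
  ultimately have eq: "wchains j s n S = wchains j 0 (n - s) ?R" for j by simp
  show "falling (n - s) j \<le> wchains j s n S" if "j < card S"
    unfolding eq using that card sub by (intro wchains_ge_falling subset_trans[OF sub]) auto
  show "extra (n - s) j \<le> wchains j s n S" if "Suc j < card S"
    unfolding eq using that card sub by (intro wchains_ge_extra) auto
qed

lemma wchains_remove_outside:
  assumes a: "Suc j \<le> a" "n + Suc j \<le> 2 * a" "2 * a \<le> n + Suc j + 1"
    and S: "S \<subseteq> {1..n - 2}" "\<not> S \<subseteq> {a - Suc j..<a}"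
  obtains i q where "i \<in> S" "i \<notin> {a - Suc j..<a}"
    "wchains (Suc j) 0 n S = real (n choose i) * q + wchains (Suc j) 0 n (S - {i})"
    "j < card S \<Longrightarrow> falling a j \<le> q" "Suc j < card S \<Longrightarrow> extra a j \<le> q"
proof -
  have fin: "finite S" using S(1) by (rule finite_subset) simp
  have ne: "S \<noteq> {}" using S(2) by auto
  have range: "1 \<le> t" "t + 2 \<le> n" if "t \<in> S" for t
    using S(1) that by fastforce+
  show ?thesis
  proof (cases "\<exists>s\<in>S. s < a - Suc j")
    case True
    define s where "s = Min S"
    have s: "s \<in> S" "\<And>t. t \<in> S \<Longrightarrow> s \<le> t" using fin ne by (auto simp: s_def)
    have sa: "s < a - Suc j" using True s(2) by fastforce
    \<comment> \<open>From s <= a - k - 1 and 2a <= n + k + 1, with k = j + 1.\<close>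
    then have le: "a \<le> n - s" using a by linarith
    show ?thesis
    proof (rule that[of s "wchains j s n S"])
      show "wchains (Suc j) 0 n S
          = real (n choose s) * wchains j s n S + wchains (Suc j) 0 n (S - {s})"
        using wchains_split_min[of s S n 0 j] s range[OF s(1)] by simp
      show "falling a j \<le> wchains j s n S" if "j < card S"
        using wchains_bottom_ge(1)[OF S(1) s that] falling_mono[OF le, of j] by linarith
      show "extra a j \<le> wchains j s n S" if "Suc j < card S"
        using wchains_bottom_ge(2)[OF S(1) s that] extra_mono[OF le, of j] by linarith
    qed (use s sa in auto)
  next
    case False
    define b where "b = Max S"
    have b: "b \<in> S" "\<And>t. t \<in> S \<Longrightarrow> t \<le> b" using fin ne by (auto simp: b_def)
    have ab: "a \<le> b"
    proof -
      obtain i where "i \<in> S" "i \<notin> {a - Suc j..<a}" using S(2) by blast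
      then show ?thesis using False b(2)[of i] by auto
    qed
    have eq: "wchains j 0 b S = wchains j 0 b (S - {b})"
      by (rule wchains_cong) auto
    have below: "S - {b} \<subseteq> {max 1 (a - Suc j)..<b}"
    proof
      fix t assume "t \<in> S - {b}"
      then show "t \<in> {max 1 (a - Suc j)..<b}" using b(2)[of t] range[of t] False by auto
    qed
    show ?thesis
    proof (rule that[of b "wchains j 0 b S"])
      show "wchains (Suc j) 0 n S
          = real (n choose b) * wchains j 0 b S + wchains (Suc j) 0 n (S - {b})"
        using wchains_split_max[of b S n 0 j] b range[OF b(1)] by simp
      show "falling a j \<le> wchains j 0 b S" if "j < card S"
      proof -
        have "falling b j \<le> wchains j 0 b (S - {b})"
          using that b fin by (intro wchains_ge_falling subset_trans[OF below]) auto
        then show ?thesis using falling_mono[OF ab, of j] by (simp add: eq)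
      qed
      show "extra a j \<le> wchains j 0 b S" if card: "Suc j < card S"
      proof -
        \<comment> \<open>More than k levels in [1, n - 2] force n >= k + 3. Then 2a >= n + k gives
          a >= k + 2, so all levels below \<open>b\<close> are at least 2.\<close>
        have "card S \<le> n - 2" using card_mono[OF _ S(1)] by simp
        then have "2 \<le> a - Suc j" using card a by linarith
        then have "extra b j \<le> wchains j 0 b (S - {b})"
          using card b fin by (intro wchains_ge_extra subset_trans[OF below]) auto
        then show ?thesis using extra_mono[OF ab, of j] by (simp add: eq)
      qed
    qed (use b ab in auto)
  qed
qed

section \<open>Layer sizes and the inequality for a single set of levels\<close>

text \<open>The hypotheses say u - n/2 >= |i - n/2|, so this is unimodality together with
  symmetry.\<close>

lemma binomial_le_of_closer:
  assumes "i \<le> u" "n \<le> i + u"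
  shows "n choose u \<le> n choose i"
proof (cases "u \<le> n")
  case True
  show ?thesis
  proof (cases "n \<le> 2 * i")
    case False
    have "n choose u = n choose (n - u)" using True by (rule binomial_symmetric)
    also have "\<dots> \<le> n choose i" using assms False by (intro binomial_mono) auto
    finally show ?thesis .
  qed (use assms True in \<open>intro binomial_antimono; auto\<close>)
qed (simp add: not_le binomial_eq_0)

text \<open>With k = j + 1, the last two assumptions say that a is (n + k)/2 rounded up.
  \<open>W\<close> is the size of layer a - 1 after the discount (k - 1)/a; it equals binom(n, a) if
  n + k is even and is at least that otherwise.\<close>

context
  fixes n a j :: nat and W :: real
  defines "W \<equiv> real (n choose (a - 1)) * real (a - j) / real a"
  assumes a: "Suc j \<le> a" "n + Suc j \<le> 2 * a" "2 * a \<le> n + Suc j + 1"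
begin

lemma binomial_next_layer: "real (n choose a) * real a = real (n choose (a - 1)) * real (n - (a - 1))"
proof -
  have "(n choose a) * a = (n choose (a - 1)) * (n - (a - 1))"
    using choose_Suc_times[of n "a - 1"] a by simp
  then show ?thesis by (metis of_nat_mult)
qed

lemma binomial_above_layers_le: "a \<le> i \<Longrightarrow> real (n choose i) \<le> W"
proof -
  assume "a \<le> i"
  have "n choose i \<le> n choose a"
    using \<open>a \<le> i\<close> a by (intro binomial_le_of_closer) auto
  note binomial_next_layer
  moreover have "real (n choose (a - 1)) * real (n - (a - 1)) \<le> real (n choose (a - 1)) * real (a - j)"
    using a by (intro mult_left_mono) auto
  moreover have "real (n choose i) * real a \<le> real (n choose a) * real a"
    using \<open>n choose i \<le> n choose a\<close> by (intro mult_right_mono) auto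
  ultimately have "real (n choose i) * real a \<le> real (n choose (a - 1)) * real (a - j)"
    by linarith
  then show ?thesis using a by (simp add: W_def pos_le_divide_eq)
qed

lemma binomial_outside_layers_le:
  assumes "i \<notin> {a - Suc j..<a}"
  shows "real (n choose i) \<le> W"
proof (cases "a \<le> i")
  case False
  then have "i < a - Suc j" using assms by auto
  then have "i \<le> n" "a \<le> n - i" using a by linarith+
  then show ?thesis using binomial_above_layers_le[of "n - i"] binomial_symmetric[of i n] by simp
qed (rule binomial_above_layers_le)

text \<open>This is the source of the factor (k - 1)/a: these layers are no smaller than layer a -
  1, and for layer a - 1 itself the discounted size is exactly \<open>W\<close>.\<close>

lemma binomial_layers_ge:
  assumes "i \<in> {a - Suc j<..<a}"
  shows "W \<le> (1 - real j / real a) * real (n choose i)"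
proof -
  have "n choose (a - 1) \<le> n choose i"
    using assms a by (intro binomial_le_of_closer) auto
  then have "W \<le> real (n choose i) * real (a - j) / real a"
    unfolding W_def by (intro divide_right_mono mult_right_mono) auto
  then show ?thesis using a by (simp add: field_simps of_nat_diff)
qed

text \<open>Layer a - k mirrors layer a if n + k is even, and then has size exactly
  \<open>W\<close>, leaving no room for a discount; otherwise it mirrors layer a - 1. Hence the
  discount starts only at layer a - k + 1.\<close>

lemma binomial_lowest_layer_ge: "W \<le> real (n choose (a - Suc j))"
proof (cases "2 * a = n + Suc j")
  case True
  note binomial_next_layer
  moreover have "n - (a - 1) = a - j" using True a by linarith
  moreover have "n choose (a - Suc j) = n choose a"
  proof -
    have "a - Suc j = n - a" "a \<le> n" using True a by linarith+
    then show ?thesis using binomial_symmetric[of a n] by simp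
  qed
  ultimately have "real (n choose (a - Suc j)) * real a = real (n choose (a - 1)) * real (a - j)"
    by simp
  then show ?thesis using a by (simp add: W_def pos_divide_le_eq)
next
  case False
  then have "n - (a - Suc j) = a - 1" "a - Suc j \<le> n" using a by linarith+
  then have "n choose (a - Suc j) = n choose (a - 1)"
    using binomial_symmetric[of "a - Suc j" n] by simp
  then show ?thesis using a by (simp add: W_def field_simps)
qed

text \<open>The first three sums on the right combine to the sum over the missing central layers,
  each of which is worth at least \<open>W\<close> even when discounted.\<close>

lemma sum_layers_exchange:
  assumes "finite S"
  shows "real (card ({a - Suc j..<a} - S)) * W
    \<le> (\<Sum>i\<in>{a - Suc j..<a}. real (n choose i)) - (\<Sum>i\<in>S. real (n choose i))
      + (\<Sum>i\<in>S - {a - Suc j..<a}. real (n choose i))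
      - real j / real a * (\<Sum>i\<in>{a - Suc j<..<a} - S. real (n choose i))"
proof -
  let ?C = "{a - Suc j..<a}" and ?C' = "{a - Suc j<..<a}" and ?b = "\<lambda>i. real (n choose i)"
  let ?w = "\<lambda>i. ?b i - (if i \<in> ?C' then real j / real a * ?b i else 0)"
  have "real (card (?C - S)) * W = (\<Sum>i\<in>?C - S. W)" by simp
  also have "\<dots> \<le> (\<Sum>i\<in>?C - S. ?w i)"
  proof (rule sum_mono)
    fix i assume "i \<in> ?C - S"
    then show "W \<le> ?w i"
      using binomial_layers_ge[of i] binomial_lowest_layer_ge
      by (cases "i = a - Suc j") (auto simp: algebra_simps)
  qed
  also have "\<dots> = (\<Sum>i\<in>?C - S. ?b i) - (\<Sum>i\<in>(?C - S) \<inter> ?C'. real j / real a * ?b i)"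
    by (simp only: sum_subtractf sum.inter_restrict[of "?C - S"] finite_Diff finite_atLeastLessThan)
  also have "(?C - S) \<inter> ?C' = ?C' - S" by auto
  also have "(\<Sum>i\<in>?C - S. ?b i) = sum ?b ?C - sum ?b (?C \<inter> S)"
    using sum.Int_Diff[of ?C ?b S] by simp
  also have "sum ?b (?C \<inter> S) = sum ?b S - sum ?b (S - ?C)"
    using sum.Int_Diff[of S ?b ?C] assms by (simp add: Int_commute)
  finally show ?thesis by (simp add: sum_distrib_left)
qed

text \<open>The induction hypothesis serves only sets of more than k levels; smaller ones are
  settled directly by exchange.\<close>

lemma wchains_layers_bound:
  assumes "S \<subseteq> {1..n - 2}"
  shows "W * falling a j - extra a j * (\<Sum>i\<in>{a - Suc j..<a}. real (n choose i))
      + real j / real a * extra a j * (\<Sum>i\<in>{a - Suc j<..<a} - S. real (n choose i))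
    \<le> wchains (Suc j) 0 n S - extra a j * (\<Sum>i\<in>S. real (n choose i))"
  using assms
proof (induction "card S" arbitrary: S rule: less_induct)
  case less
  let ?C = "{a - Suc j..<a}" and ?C' = "{a - Suc j<..<a}" and ?b = "\<lambda>i. real (n choose i)"
  let ?D = "extra a j"
  have fin: "finite S" using less.prems by (rule finite_subset) simp
  have D0: "0 \<le> ?D" using falling_nonneg[of a j] falling_le_extra[of a j] by linarith
  have W0: "0 \<le> W" by (simp add: W_def)
  have WD: "W * falling a j \<le> W * ?D" using W0 falling_le_extra by (rule mult_left_mono[rotated])
  \<comment> \<open>Each of the \<open>x\<close> missing central levels is worth at least
    \<open>W\<close>, each of the \<open>y\<close> outside levels at most \<open>W\<close>. The
    exchange therefore gains at least x - y = k - |S| times \<open>W\<close>.\<close>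
  define x y where "x = card (?C - S)" and "y = card (S - ?C)"
  have xy: "x + card S = Suc j + y"
  proof -
    have split: "card (A - B) + card (A \<inter> B) = card A" if "finite A" for A B :: "nat set"
      using that card_mono[of A "A \<inter> B"] by (simp add: card_Diff_subset_Int)
    have "x + card (?C \<inter> S) = card ?C" "y + card (S \<inter> ?C) = card S"
      unfolding x_def y_def by (rule split, simp add: fin)+
    then have "x + card S = card ?C + y" by (simp add: Int_commute)
    then show ?thesis using a by simp
  qed
  have out: "sum ?b B \<le> real (card B) * W" if "B \<inter> ?C = {}" for B
    using that by (intro sum_bounded_above) (use binomial_outside_layers_le in blast)
  have exch: "?D * (real x * W) \<le> ?D * (sum ?b ?C - sum ?b S + sum ?b (S - ?C)
      - real j / real a * sum ?b (?C' - S))"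
    using sum_layers_exchange[OF fin] D0 unfolding x_def by (rule mult_left_mono)
  have Q0: "0 \<le> wchains (Suc j) 0 n S" by (rule wchains_nonneg)
  consider (small) "card S \<le> j" | (centre) "card S = Suc j" "S \<subseteq> ?C"
    | (outside) "card S = Suc j" "\<not> S \<subseteq> ?C" | (large) "Suc j < card S"
    by linarith
  then show ?case
  proof cases
    case small
    \<comment> \<open>Here x >= y + 1, and the one spare \<open>?D * W\<close> already covers the
      base, so the chain weight need only be nonnegative.\<close>
    have "?D * sum ?b (S - ?C) \<le> ?D * (real y * W)"
      unfolding y_def using D0 by (intro mult_left_mono out) auto
    moreover have "?D * ((real y + 1) * W) \<le> ?D * (real x * W)"
      using xy small D0 W0 by (intro mult_left_mono mult_right_mono) auto
    ultimately show ?thesis using exch WD Q0 by (simp add: algebra_simps)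
  next
    case centre
    then have S: "S = ?C" using a by (intro card_subset_eq) auto
    \<comment> \<open>The layer sums cancel and only the base remains. Selections with top level a -
      1 suffice to reach it.\<close>
    have "real (n choose (a - 1)) * falling (a - 1) j \<le> wchains (Suc j) 0 n S"
    proof -
      have mem: "a - Suc j \<in> S" "a - 1 \<in> S" unfolding S using a by auto
      then have "a - Suc j \<in> {1..n - 2}" "a - 1 \<in> {1..n - 2}" using less.prems by blast+
      then have pos: "1 \<le> a - Suc j" "a - 1 < n" "a - 1 \<in> S" "0 < a - 1" using mem by auto
      have "falling (a - 1) j \<le> wchains j 0 (a - 1) ({a - Suc j..<a - 1})"
        using pos a by (intro wchains_ge_falling) auto
      also have "\<dots> = wchains j 0 (a - 1) S"
        unfolding S using a by (intro wchains_cong) auto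
      finally have "real (n choose (a - 1)) * falling (a - 1) j
          \<le> real (n choose (a - 1)) * wchains j 0 (a - 1) S"
        by (intro mult_left_mono) auto
      also have "\<dots> \<le> wchains (Suc j) 0 n S"
      proof -
        have "t \<le> a - 1" if "t \<in> S" for t using that S by auto
        then have "wchains (Suc j) 0 n S = real ((n - 0) choose (a - 1 - 0)) * wchains j 0 (a - 1) S
            + wchains (Suc j) 0 n (S - {a - 1})"
          using pos by (intro wchains_split_max) auto
        then show ?thesis using wchains_nonneg[of "Suc j" 0 n "S - {a - 1}"] by (simp only: diff_zero)
      qed
      finally show ?thesis .
    qed
    moreover have "W * falling a j = real (n choose (a - 1)) * falling (a - 1) j"
      unfolding W_def using a by (intro choose_times_falling_pred) auto
    moreover have "sum ?b (?C' - S) = 0" unfolding S by (intro sum.neutral) auto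
    moreover have "sum ?b S = sum ?b ?C" by (simp only: S)
    ultimately show ?thesis by (simp del: wchains.simps)
  next
    case outside
    then obtain i q where i: "i \<in> S" "i \<notin> ?C" "falling a j \<le> q"
        "wchains (Suc j) 0 n S = ?b i * q + wchains (Suc j) 0 n (S - {i})"
      using wchains_remove_outside[OF a less.prems outside(2)] by (metis lessI)
    have "sum ?b (S - ?C) = ?b i + sum ?b (S - ?C - {i})"
      using i fin by (intro sum.remove) auto
    moreover have "sum ?b (S - ?C - {i}) \<le> real (card (S - ?C - {i})) * W"
      by (rule out) auto
    moreover have "card (S - ?C - {i}) = y - 1"
      using i fin by (simp add: y_def)
    moreover have "x = y" using xy outside by simp
    moreover have "y \<noteq> 0" using i fin by (auto simp: y_def)
    ultimately have "sum ?b (S - ?C) \<le> ?b i + (real x - 1) * W"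
      by (simp add: of_nat_diff)
    then have "?D * sum ?b (S - ?C) \<le> ?D * (?b i + (real x - 1) * W)"
      using D0 by (rule mult_left_mono)
    \<comment> \<open>The exchange leaves a surplus \<open>?D * (W - ?b i)\<close>, enough for the
      part \<open>falling a j * (W - ?b i)\<close> of the base. The remaining
      \<open>falling a j * ?b i\<close> is paid by the selections through \<open>i\<close>.\<close>
    moreover have "falling a j * (W - ?b i) \<le> ?D * (W - ?b i)"
      using binomial_outside_layers_le[OF i(2)] falling_le_extra by (intro mult_right_mono) auto
    moreover have "?b i * falling a j \<le> wchains (Suc j) 0 n S"
      using i(3,4) wchains_nonneg[of "Suc j" 0 n "S - {i}"] mult_left_mono[OF i(3), of "?b i"] by linarith
    ultimately show ?thesis using exch by (simp add: algebra_simps)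
  next
    case large
    \<comment> \<open>The centre has only k levels. The removed level carries weight at least
      \<open>?D * ?b i\<close>, and since it lies outside the centre, \<open>?C' - S\<close> does
      not change.\<close>
    then have "\<not> S \<subseteq> ?C" using card_mono[of ?C S] a by auto
    then obtain i q where i: "i \<in> S" "i \<notin> ?C" "?D \<le> q"
        "wchains (Suc j) 0 n S = ?b i * q + wchains (Suc j) 0 n (S - {i})"
      using wchains_remove_outside[OF a less.prems] large by metis
    have "card (S - {i}) < card S" using fin i(1) by (rule card_Diff1_less)
    moreover have "S - {i} \<subseteq> {1..n - 2}" using less.prems by auto
    moreover have "?C' - (S - {i}) = ?C' - S" using i(2) by auto
    ultimately have "W * falling a j - ?D * sum ?b ?C + real j / real a * ?D * sum ?b (?C' - S)
        \<le> wchains (Suc j) 0 n (S - {i}) - ?D * sum ?b (S - {i})"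
      using less.hyps[of "S - {i}"] by simp
    moreover have "sum ?b S = ?b i + sum ?b (S - {i})"
      using i fin by (intro sum.remove) auto
    moreover have "?b i * ?D \<le> ?b i * q" using i(3) by (intro mult_left_mono) auto
    ultimately show ?thesis using i(4) by (simp add: algebra_simps)
  qed
qed

end

section \<open>Averaging and the final estimate\<close>

lemma extra_eq_binomials:
  "extra a j = (real (a choose j) + real (a choose Suc j) * real (Suc j choose 2)) * fact j"
  unfolding real_choose_two extra_def falling_def fact_Suc
  by (simp add: algebra_simps del: binomial_Suc_Suc)

lemma largest_layers_eq:
  assumes "k \<le> upper_level n k"
  shows "largest_layers n k = (\<Sum>i\<in>{upper_level n k - k..<upper_level n k}. n choose i)"
  unfolding largest_layers_def
  by (rule sum.reindex_bij_witness[where i = int and j = nat])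
     (use assms in \<open>auto simp: int_choose_def\<close>)

text \<open>The inequality for a set of levels is summed over all permutations of \<open>A\<close>
  and divided by n!. The number of missing central sets enters by averaging layer sizes over the
  family \<open>\<G>\<close> of these sets as well.\<close>

lemma num_chains_lower_bound:
  fixes \<F> :: "'a set set"
  assumes A: "finite A" "card A = n"
    and a: "Suc j \<le> a" "n + Suc j \<le> 2 * a" "2 * a \<le> n + Suc j + 1"
    and \<F>: "\<F> \<subseteq> Pow A" "\<And>F. F \<in> \<F> \<Longrightarrow> 1 \<le> card F \<and> card F + 2 \<le> n"
  shows "real (n choose (a - 1)) * falling (a - 1) j
      + (real (card \<F>) - (\<Sum>i\<in>{a - Suc j..<a}. real (n choose i))
         + real j / real a * real (card {G. G \<subseteq> A \<and> card G \<in> {a - Suc j<..<a} \<and> G \<notin> \<F>}))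
        * extra a j
    \<le> real (num_chains (Suc j) \<F>)"
proof -
  let ?P = "permutations_of_set A" and ?b = "\<lambda>i. real (n choose i)" and ?D = "extra a j"
  define \<G> where "\<G> = {G. G \<subseteq> A \<and> card G \<in> {a - Suc j<..<a} \<and> G \<notin> \<F>}"
  define L where "L xs = {..n} \<inter> levels \<F> xs" for xs :: "'a list"
  define M where "M xs = {..n} \<inter> levels \<G> xs" for xs :: "'a list"
  define B where "B = real (n choose (a - 1)) * real (a - j) / real a * falling a j"
  define m where "m = (\<Sum>i\<in>{a - Suc j..<a}. ?b i)"
  have card_prefix: "card (set (take t xs)) = t" "set (take t xs) \<subseteq> A"
    if "xs \<in> ?P" "t \<le> n" for t xs
    using that A(2) set_take_subset[of t xs]
    by (auto simp: permutations_of_set_def distinct_card)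
  have pointwise: "B - ?D * m + real j / real a * ?D * sum ?b (M xs)
      \<le> wchains (Suc j) 0 n (levels \<F> xs) - ?D * sum ?b (L xs)" if xs: "xs \<in> ?P" for xs
  proof -
    have L: "L xs \<subseteq> {1..n - 2}"
    proof
      fix t assume "t \<in> L xs"
      then have "t \<le> n" "set (take t xs) \<in> \<F>" by (auto simp: L_def levels_def)
      then have "1 \<le> t" "t + 2 \<le> n"
        using \<F>(2)[of "set (take t xs)"] card_prefix[OF xs, of t] by simp_all
      then show "t \<in> {1..n - 2}" by auto
    qed
    \<comment> \<open>A maximal chain has one set per level, so a level where it meets
      \<open>\<G>\<close> is a central level where it misses \<open>\<F>\<close>.\<close>
    have "sum ?b (M xs) \<le> sum ?b ({a - Suc j<..<a} - L xs)"
    proof (intro sum_mono2 subsetI)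
      fix t assume "t \<in> M xs"
      then show "t \<in> {a - Suc j<..<a} - L xs"
        using card_prefix[OF xs, of t] by (auto simp: M_def L_def levels_def \<G>_def)
    qed auto
    then have "real j / real a * ?D * sum ?b (M xs)
        \<le> real j / real a * ?D * sum ?b ({a - Suc j<..<a} - L xs)"
      using falling_nonneg[of a j] falling_le_extra[of a j] by (intro mult_left_mono) auto
    moreover have "wchains (Suc j) 0 n (levels \<F> xs) = wchains (Suc j) 0 n (L xs)"
      by (rule wchains_cong) (auto simp: L_def)
    moreover note wchains_layers_bound[OF a L]
    ultimately show ?thesis unfolding B_def m_def by linarith
  qed
  have "(\<Sum>xs\<in>?P. B - ?D * m + real j / real a * ?D * sum ?b (M xs))
      \<le> (\<Sum>xs\<in>?P. wchains (Suc j) 0 n (levels \<F> xs) - ?D * sum ?b (L xs))"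
    by (rule sum_mono) (rule pointwise)
  also have "(\<Sum>xs\<in>?P. wchains (Suc j) 0 n (levels \<F> xs) - ?D * sum ?b (L xs))
      = fact n * real (num_chains (Suc j) \<F>) - ?D * (fact n * real (card \<F>))"
  proof -
    have "{} \<notin> \<F>" using \<F>(2)[of "{}"] by auto
    have "{B \<in> \<F>. B \<subset> A} = \<F>" using \<F> A(2) by fastforce
    then have "(\<Sum>xs\<in>?P. wchains (Suc j) 0 n (levels \<F> xs)) = fact n * real (num_chains (Suc j) \<F>)"
      using sum_wchains_levels[OF A(1) \<open>{} \<notin> \<F>\<close>, of "Suc j"] by (simp only: A(2))
    moreover have "(\<Sum>xs\<in>?P. sum ?b (L xs)) = fact n * real (card \<F>)"
      using sum_choose_levels[OF A(1) \<F>(1)] by (simp only: A(2) L_def)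
    ultimately show ?thesis by (simp only: sum_subtractf flip: sum_distrib_left)
  qed
  also have "(\<Sum>xs\<in>?P. B - ?D * m + real j / real a * ?D * sum ?b (M xs))
      = fact n * (B - ?D * m) + real j / real a * ?D * (fact n * real (card \<G>))"
  proof -
    have "(\<Sum>xs\<in>?P. sum ?b (M xs)) = fact n * real (card \<G>)"
      using sum_choose_levels[OF A(1), of \<G>] by (auto simp: A(2) M_def \<G>_def)
    then show ?thesis
      using A by (simp only: sum.distrib sum_constant card_permutations_of_set of_nat_fact
          flip: sum_distrib_left)
  qed
  finally have "fact n * (B - ?D * m + real j / real a * ?D * real (card \<G>))
      \<le> fact n * (real (num_chains (Suc j) \<F>) - ?D * real (card \<F>))"
    by (simp add: algebra_simps)
  then have "B - ?D * m + real j / real a * ?D * real (card \<G>)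
      \<le> real (num_chains (Suc j) \<F>) - ?D * real (card \<F>)"
    by (rule mult_left_le_imp_le) simp
  moreover have "B = real (n choose (a - 1)) * falling (a - 1) j"
    unfolding B_def by (rule choose_times_falling_pred) (use a in simp)
  ultimately show ?thesis by (simp add: m_def \<G>_def algebra_simps)
qed

theorem theorem4p2:
  fixes n k a t2 :: nat and t1 :: int and \<F> :: "nat set set"
  assumes "n \<ge> 1" and "k \<ge> 2"
    and "a = upper_level n k"
    and "\<F> \<subseteq> Pow {1..n}"
    and "int (card \<F>) = int (largest_layers n k) + t1"
    and "\<And>F. F \<in> \<F> \<Longrightarrow> 1 \<le> card F \<and> int (card F) \<le> int n - 2"
    and "t2 \<le> card {G. G \<subseteq> {1..n} \<and> int a - int k + 1 \<le> int (card G)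
                     \<and> int (card G) \<le> int a - 1 \<and> G \<notin> \<F>}"
  shows "real (num_chains k \<F>) \<ge>
      real (int_choose n (int a - int k)) * real ((n + k - a) choose (k - 1)) * fact (k - 1)
    + (real_of_int t1 + (real k - 1) / real a * real t2)
        * (real (a choose (k - 1)) + real (a choose k) * real (k choose 2)) * fact (k - 1)"
proof -
  define j where "j = k - 1"
  have k: "k = Suc j" "1 \<le> j" using assms(2) by (auto simp: j_def)
  have a: "n + Suc j \<le> 2 * a" "2 * a \<le> n + Suc j + 1"
  proof -
    have "int a = \<lceil>real (n + k) / 2\<rceil>" unfolding assms(3) upper_level_def by simp
    then have "real (n + k) / 2 \<le> real a" "real a < real (n + k) / 2 + 1"
      by linarith+
    then have "real (n + k) \<le> real (2 * a)" and less: "real (2 * a) < real (n + k + 2)"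
      by (simp_all add: field_simps)
    then have "n + k \<le> 2 * a" by (simp only: of_nat_le_iff)
    moreover from less have "2 * a < n + k + 2" by (simp only: of_nat_less_iff)
    ultimately show "n + Suc j \<le> 2 * a" "2 * a \<le> n + Suc j + 1"
      using k(1) by linarith+
  qed
  define \<G> where "\<G> = {G. G \<subseteq> {1..n} \<and> int a - int k + 1 \<le> int (card G)
                     \<and> int (card G) \<le> int a - 1 \<and> G \<notin> \<F>}"
  have D: "extra a j = (real (a choose (k - 1)) + real (a choose k) * real (k choose 2)) * fact (k - 1)"
    by (simp add: extra_eq_binomials k(1) del: binomial_Suc_Suc)
  have D0: "0 \<le> extra a j" using falling_nonneg[of a j] falling_le_extra[of a j] by linarith
  define X where "X = real_of_int t1 + real j / real a * real t2"
  have goal: ?thesis if "real (int_choose n (int a - int k)) * falling (n + k - a) j + X * extra a j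
      \<le> real (num_chains k \<F>)"
    using that unfolding D X_def by (simp add: k(1) falling_def mult.assoc del: binomial_Suc_Suc)
  show ?thesis
  proof (cases "k \<le> a")
    case True
    have \<G>: "\<G> = {G. G \<subseteq> {1..n} \<and> card G \<in> {a - Suc j<..<a} \<and> G \<notin> \<F>}"
      unfolding \<G>_def using True k by (intro Collect_cong) auto
    have "real_of_int t1 = real (card \<F>) - (\<Sum>i\<in>{a - Suc j..<a}. real (n choose i))"
    proof -
      have "real (largest_layers n k) = (\<Sum>i\<in>{a - Suc j..<a}. real (n choose i))"
        using largest_layers_eq[of k n] True by (simp add: assms(3) k(1))
      moreover have "real (card \<F>) = real (largest_layers n k) + real_of_int t1"
        using assms(5) by linarith
      ultimately show ?thesis by simp
    qed
    moreover have "real j / real a * real t2 \<le> real j / real a * real (card \<G>)"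
      using assms(7) by (intro mult_left_mono) (auto simp: \<G>_def)
    ultimately have "X * extra a j \<le> (real (card \<F>) - (\<Sum>i\<in>{a - Suc j..<a}. real (n choose i))
        + real j / real a * real (card \<G>)) * extra a j"
      unfolding X_def using D0 by (intro mult_right_mono) auto
    moreover have "real (n choose (a - 1)) * falling (a - 1) j
        + (real (card \<F>) - (\<Sum>i\<in>{a - Suc j..<a}. real (n choose i))
           + real j / real a * real (card \<G>)) * extra a j \<le> real (num_chains (Suc j) \<F>)"
      unfolding \<G>
    proof (rule num_chains_lower_bound)
      show "1 \<le> card F \<and> card F + 2 \<le> n" if "F \<in> \<F>" for F
        using assms(6)[OF that] by linarith
    qed (use a True k assms(4) in auto)
    \<comment> \<open>Up to the factor (k - 1)!, both sides count pairs of an (a - k)-set inside an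
      (a - 1)-subset of [n].\<close>
    moreover have "real (int_choose n (int a - int k)) * falling (n + k - a) j
        = real (n choose (a - 1)) * falling (a - 1) j"
    proof (cases "a - 1 \<le> n")
      case le: True
      have "(n choose (a - 1)) * ((a - 1) choose (a - k))
          = (n choose (a - k)) * ((n - (a - k)) choose (a - 1 - (a - k)))"
        using True k le by (intro choose_mult) auto
      moreover have "n - (a - k) = n + k - a" "a - 1 - (a - k) = j" using True k le by auto
      moreover have "(a - 1) choose (a - k) = (a - 1) choose j"
        using binomial_symmetric[of j "a - 1"] True k by simp
      ultimately have "real (n choose (a - k)) * real ((n + k - a) choose j)
          = real (n choose (a - 1)) * real ((a - 1) choose j)"
        by (metis of_nat_mult)
      moreover have "int_choose n (int a - int k) = n choose (a - k)"
        using True by (simp add: int_choose_def nat_diff_distrib)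
      ultimately show ?thesis by (simp add: falling_def)
    next
      case gt: False
      \<comment> \<open>Now a - 1 > n and both sides are 0.\<close>
      then have "n + k - a < j" using a k by linarith
      with gt show ?thesis by (simp add: falling_def binomial_eq_0)
    qed
    ultimately show ?thesis by (intro goal) (simp add: k(1))
  next
    case False
    \<comment> \<open>For k > a the lowest layer has a negative index, so the first summand is 0 and
      it remains to see that the second is not positive.\<close>
    then have "int_choose n (int a - int k) = 0" by (simp add: int_choose_def)
    moreover have "X * extra a j \<le> 0"
    proof (cases "a = j")
      case True
      \<comment> \<open>With a = k - 1 the layers -1, ..., a - 1 cover all of 0, ..., n, so M_k >=
        2^n. Since \<open>\<F>\<close> and \<open>\<G>\<close> are disjoint, t1 + t2 <= 0, and here
        the factor (k - 1)/a is 1.\<close>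
      have "n \<le> a - 1" using a True by linarith
      have "2 ^ n = (\<Sum>i\<le>n. n choose i)" by (simp add: choose_row_sum)
      also have "\<dots> = (\<Sum>i\<in>int ` {..n}. int_choose n i)"
        by (simp add: sum.reindex int_choose_def)
      also have "\<dots> \<le> largest_layers n k"
        unfolding largest_layers_def assms(3)[symmetric] using \<open>n \<le> a - 1\<close> True k
        by (intro sum_mono2) auto
      finally have "2 ^ n \<le> largest_layers n k" .
      moreover have "card \<F> + card \<G> \<le> 2 ^ n"
      proof -
        have "\<G> \<subseteq> Pow {1..n}" by (auto simp: \<G>_def)
        then have "finite \<F>" "finite \<G>"
          using assms(4) finite_subset[of _ "Pow {1..n}"] by blast+
        then have "card \<F> + card \<G> = card (\<F> \<union> \<G>)"
          by (intro card_Un_disjoint[symmetric]) (auto simp: \<G>_def)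
        also have "\<dots> \<le> card (Pow {1..n})"
          using assms(4) by (intro card_mono) (auto simp: \<G>_def)
        finally show ?thesis by (simp add: card_Pow)
      qed
      moreover have "t2 \<le> card \<G>" using assms(7) by (simp add: \<G>_def)
      ultimately have "t1 + int t2 \<le> 0" using assms(5) by linarith
      moreover have "X = of_int (t1 + int t2)" using True k by (simp add: X_def)
      ultimately show ?thesis using D0 by (intro mult_nonpos_nonneg) (simp_all only: of_int_le_0_iff)
    next
      case False
      \<comment> \<open>Both binomial coefficients in \<open>extra a j\<close> now vanish.\<close>
      then have "a < j" using \<open>\<not> k \<le> a\<close> k by simp
      then show ?thesis by (simp add: extra_def falling_def binomial_eq_0)
    qed
    ultimately show ?thesis by (intro goal) simp
  qed
qed

end
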